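(* Let $p\ge 1$, let $F$ be a probability distribution on $\mathbb{R}^p$, and let $G$ be a cumulative distribution function on $\mathbb{R}$. Assume that there exist $q\in\mathbb{R}$ and sequences $c_m\in\mathbb{R}$, $d_m>0$ such that $$G(c_m+d_m z)=\frac{1}{m}\exp_q(z)+o(m^{-1})\quad (m\to\infty)\ \text{ for each } z\in\mathbb{R}.$$ Fix $(\alpha,\beta)\in\mathbb{R}\times\mathbb{R}^p$. For each $m$, let $P_{m,\alpha,\beta}$ be the law of $m$ independent and identically distributed pairs $(X_i,Y_i)\in\mathbb{R}^p\times\{0,1\}$, $i=1,\dots,m$, where $X_i$ has distribution $F$ and $$P_{m,\alpha,\beta}(Y_i=1\mid X_i)=G\big(a_m(\alpha)+b_m(\beta)^{\top}X_i\big),\qquad a_m(\alpha)=c_m+d_m\alpha,\quad b_m(\beta)=d_m\beta .$$ Denote by $\{x_i\}_{i=1}^n$ the observations $X_i$ for which $Y_i=1$ (counted with multiplicity). Then, under $P_{m,\alpha,\beta}$, $\{x_i\}_{i=1}^n$ converges in law, as $m\to\infty$, to the Poisson point process with intensity measure $\lambda(dx)=\exp_q(\alpha+\beta^{\top}x)F(dx)$, in the following precise sense: for every positive integer $J$, all non-negative integers $n_1,\dots,n_J$, and all mutually disjoint compact subsets $A_1,\dots,A_J$ of $\mathbb{R}^p$ such that $\exp_q(\alpha+\beta^{\top}x)$ is finite for all $x\in A_j$, $j=1,\dots,J$, $$\lim_{m\to\infty}P_{m,\alpha,\beta}\big(\#\{i\mid x_i\in A_j\}=n_j,\ j=1,\dots,J\big)=\prod_{j=1}^J\frac{\lambda(A_j)^{n_j}e^{-\lambda(A_j)}}{n_j!},$$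 where $\lambda(A_j)=\int_{A_j}\exp_q(\alpha+\beta^{\top}x)F(dx)$.
   Context: For real $q$, the $q$-exponential function is $\exp_q(z)=e^z$ if $q=1$ and $\exp_q(z)=[1+(1-q)z]_+^{1/(1-q)}$ if $q\neq 1$, where $[z]_+=\max(z,0)$; when $q>1$, a negative power of $0$ is interpreted as $\infty$, so $\exp_q(z)=\infty$ for $z\ge -1/(1-q)$. The condition $G(c_m+d_mz)=\frac1m\exp_q(z)+o(m^{-1})$ means $mG(c_m+d_mz)\to\exp_q(z)$ in $[0,\infty]$ (so $mG(c_m+d_mz)\to\infty$ when $\exp_q(z)=\infty$). *)

theory Defs
  imports "HOL-Probability.Probability"
begin

text \<open>The q-exponential takes values in the extended half-line: for q > 1 the exponent
  1 / (1 - q) is negative, and a negative power of 0 is infinite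
  (whereas \<open>0 powr a = 0\<close> in the library, also for negative a).\<close>

definition exp_q :: "real \<Rightarrow> real \<Rightarrow> ennreal" where
  "exp_q q z =
    (if q = 1 then ennreal (exp z)
     else if q > 1 \<and> max (1 + (1 - q) * z) 0 = 0 then \<infinity>
     else ennreal (max (1 + (1 - q) * z) 0 powr (1 / (1 - q))))"

text \<open>The pairs \<open>(X i, Y i)\<close>, \<open>1 \<le> i \<le> m\<close>, are independent, \<open>X i\<close> has law \<open>F\<close>, \<open>Y i\<close> is
  0-1-valued, and the conditional probability of \<open>Y i = 1\<close> given the sigma-algebra generated
  by \<open>X i\<close> is \<open>\<pi> (X i)\<close>. The last three conditions determine the joint law of each pair, so
  the pairs are identically distributed.\<close>

definition iid_binary_sample ::
  "'w measure \<Rightarrow> nat \<Rightarrow> (real ^ 'p) measure \<Rightarrow> (real ^ 'p \<Rightarrow> real)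
    \<Rightarrow> (nat \<Rightarrow> 'w \<Rightarrow> real ^ 'p) \<Rightarrow> (nat \<Rightarrow> 'w \<Rightarrow> nat) \<Rightarrow> bool" where
  "iid_binary_sample M m F \<pi> X Y \<longleftrightarrow>
     prob_space M \<and>
     prob_space.indep_vars M (\<lambda>_. borel \<Otimes>\<^sub>M count_space UNIV) (\<lambda>i \<omega>. (X i \<omega>, Y i \<omega>)) {1..m} \<and>
     (\<forall>i\<in>{1..m}.
        distr M borel (X i) = F \<and>
        (\<forall>\<omega>\<in>space M. Y i \<omega> \<in> {0, 1}) \<and>
        (AE \<omega> in M.
           real_cond_exp M (vimage_algebra (space M) (X i) borel)
             (indicator {\<omega> \<in> space M. Y i \<omega> = 1}) \<omega> = \<pi> (X i \<omega>)))"

definition num_observed ::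
  "nat \<Rightarrow> (nat \<Rightarrow> 'w \<Rightarrow> real ^ 'p) \<Rightarrow> (nat \<Rightarrow> 'w \<Rightarrow> nat) \<Rightarrow> 'w \<Rightarrow> (real ^ 'p) set \<Rightarrow> nat" where
  "num_observed m X Y \<omega> A = card {i \<in> {1..m}. Y i \<omega> = 1 \<and> X i \<omega> \<in> A}"

definition intensity ::
  "(real ^ 'p) measure \<Rightarrow> real \<Rightarrow> real \<Rightarrow> real ^ 'p \<Rightarrow> (real ^ 'p) measure" where
  "intensity F q \<alpha> \<beta> = density F (\<lambda>x. exp_q q (\<alpha> + \<beta> \<bullet> x))"

end

theory Submission
  imports Defs "HOL-Combinatorics.Multiset_Permutations"
begin

text \<open>
  For fixed \<open>m\<close>, sort the \<open>m\<close> independent pairs into cells: pair \<open>i\<close> falls into cell \<open>j\<close> if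
  \<open>Y i = 1\<close> and \<open>X i \<in> A j\<close>, and into a residual cell otherwise. Since the \<open>A j\<close> are disjoint,
  the observed counts are the counts of a multinomial experiment (\<open>prob_multinomial\<close>),
  whose cell probabilities are \<open>p m j = \<integral>x\<in>A j. G (c m + d m * (\<alpha> + \<beta> \<bullet> x)) \<partial>F\<close> by the
  defining property of conditional probability (\<open>prob_joint_eq_integral_cond_prob\<close>).

  Each cell is rare: \<open>m * p m j\<close> converges to the intensity of \<open>A j\<close>. Pointwise, this is the
  assumption on the tail of \<open>G\<close>. To pass to the limit under the integral, a bound that is
  uniform over \<open>A j\<close> and \<open>m\<close> is needed. Since \<open>G\<close> is monotone, the integrand is at most its
  value at a point \<open>x0\<close> where the linear form \<open>\<beta> \<bullet> x\<close> attains its maximum on the compact set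
  \<open>A j\<close>, and at that single point the scaled values converge to a finite limit and so are
  bounded (\<open>scaled_integral_tendsto_intensity\<close>).

  The claim is then the law of rare events for several cells: multinomial probabilities with
  \<open>m * p m j\<close> convergent tend to products of Poisson probabilities
  (\<open>multinomial_tendsto_poisson\<close>). Independence of the limiting counts comes from the
  factorisation of the exponential of a sum in the limit of the residual cell's factor.
\<close>

section \<open>Poisson limit of multinomial probabilities\<close>

lemma fact_ratio_tendsto_1: "(\<lambda>m. fact m / (fact (m - s) * real m ^ s)) \<longlonglongrightarrow> (1::real)"
proof (induction s)
  case 0
  then show ?case by simp
next
  case (Suc s)
  have "(\<lambda>m. 1 - real s / real m) \<longlonglongrightarrow> 1 - 0"
    by (intro tendsto_diff tendsto_const lim_const_over_n)
  with Suc have "(\<lambda>m. fact m / (fact (m - s) * real m ^ s) * (1 - real s / real m)) \<longlonglongrightarrow> 1 * (1 - 0)"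
    by (intro tendsto_mult)
  moreover have "\<forall>\<^sub>F m in sequentially. fact m / (fact (m - s) * real m ^ s) * (1 - real s / real m)
      = fact m / (fact (m - Suc s) * real m ^ Suc s)"
    using eventually_gt_at_top[of s]
  proof eventually_elim
    case (elim m)
    then have "m - s = Suc (m - Suc s)" by simp
    then have "fact (m - s) = real (m - s) * fact (m - Suc s)"
      by (metis fact_Suc of_nat_fact of_nat_mult)
    moreover have "real (m - s) > 0" "real m > 0" using elim by simp_all
    moreover have "1 - real s / real m = real (m - s) / real m"
      using elim by (simp add: field_simps of_nat_diff)
    ultimately show ?case by simp
  qed
  ultimately show ?case by (simp add: tendsto_cong)
qed

text \<open>The power is squeezed by \<open>exp (- t / (1 - t)) \<le> 1 - t \<le> exp (- t)\<close>, valid for \<open>t < 1\<close>. Both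
  bounds are instances of \<open>1 + u \<le> exp u\<close>, the lower one with \<open>u = t / (1 - t)\<close>, for which
  \<open>1 + u = 1 / (1 - t)\<close>. This allows an exponent that is not the index of the sequence.\<close>

lemma power_one_minus_tendsto_exp:
  fixes t :: "nat \<Rightarrow> real" and k :: "nat \<Rightarrow> nat"
  assumes t: "t \<longlonglongrightarrow> 0" and kt: "(\<lambda>m. real (k m) * t m) \<longlonglongrightarrow> L"
  shows "(\<lambda>m. (1 - t m) ^ k m) \<longlonglongrightarrow> exp (- L)"
proof (rule tendsto_sandwich)
  have ev: "\<forall>\<^sub>F m in sequentially. t m < 1"
    using t by (rule order_tendstoD) simp
  show "\<forall>\<^sub>F m in sequentially. exp (- (real (k m) * t m / (1 - t m))) \<le> (1 - t m) ^ k m"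
    using ev
  proof eventually_elim
    case (elim m)
    have "1 / (1 - t m) = 1 + t m / (1 - t m)"
      using elim by (simp add: field_simps)
    also have "\<dots> \<le> exp (t m / (1 - t m))" by simp
    finally have "exp (- (t m / (1 - t m))) \<le> 1 - t m"
      using elim by (simp add: exp_minus field_simps)
    then have "exp (- (t m / (1 - t m))) ^ k m \<le> (1 - t m) ^ k m"
      by (rule power_mono) simp
    then show ?case
      by (simp add: exp_of_nat_mult[symmetric])
  qed
  show "\<forall>\<^sub>F m in sequentially. (1 - t m) ^ k m \<le> exp (- (real (k m) * t m))"
    using ev
  proof eventually_elim
    case (elim m)
    have "1 - t m \<le> exp (- t m)"
      using exp_ge_add_one_self[of "- t m"] by simp
    then have "(1 - t m) ^ k m \<le> exp (- t m) ^ k m"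
      using elim by (intro power_mono) simp_all
    then show ?case
      by (simp add: exp_of_nat_mult[symmetric])
  qed
  have "(\<lambda>m. exp (- (real (k m) * t m / (1 - t m)))) \<longlonglongrightarrow> exp (- (L / (1 - 0)))"
    using t kt by (intro tendsto_intros) simp_all
  then show "(\<lambda>m. exp (- (real (k m) * t m / (1 - t m)))) \<longlonglongrightarrow> exp (- L)" by simp
  show "(\<lambda>m. exp (- (real (k m) * t m))) \<longlonglongrightarrow> exp (- L)"
    using kt by (intro tendsto_intros)
qed

lemma tendsto_0_if_mult_index_tendsto:
  fixes t :: "nat \<Rightarrow> real"
  assumes "(\<lambda>m. real m * t m) \<longlonglongrightarrow> L"
  shows "t \<longlonglongrightarrow> 0"
proof -
  have "(\<lambda>m. real m * t m * (1 / real m)) \<longlonglongrightarrow> L * 0"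
    by (intro tendsto_mult assms lim_const_over_n)
  moreover have "\<forall>\<^sub>F m in sequentially. real m * t m * (1 / real m) = t m"
    using eventually_gt_at_top[of 0] by eventually_elim simp
  ultimately show ?thesis by (simp add: tendsto_cong)
qed

text \<open>With \<open>s\<close> the sum of the \<open>n k\<close>, the powers of the \<open>p m k\<close> absorb a factor \<open>m ^ s\<close>, which the
  falling factorial \<open>fact m / fact (m - s)\<close> pays for asymptotically. What remains is the power of
  the residual probability, whose limit is the exponential of minus the sum of the \<open>l k\<close>.\<close>

lemma multinomial_tendsto_poisson:
  fixes p :: "nat \<Rightarrow> 'k \<Rightarrow> real" and l :: "'k \<Rightarrow> real" and n :: "'k \<Rightarrow> nat"
  assumes mp: "\<And>k. k \<in> K \<Longrightarrow> (\<lambda>m. real m * p m k) \<longlonglongrightarrow> l k"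
  shows "(\<lambda>m. fact m / (fact (m - sum n K) * (\<Prod>k\<in>K. fact (n k)))
              * (\<Prod>k\<in>K. p m k ^ n k) * (1 - (\<Sum>k\<in>K. p m k)) ^ (m - sum n K))
         \<longlonglongrightarrow> (\<Prod>k\<in>K. l k ^ n k * exp (- l k) / fact (n k))"
proof (cases "finite K")
  case fin: True
  define s where "s = sum n K"
  define t where "t = (\<lambda>m. \<Sum>k\<in>K. p m k)"
  have mt: "(\<lambda>m. real m * t m) \<longlonglongrightarrow> sum l K"
    unfolding t_def sum_distrib_left using mp by (rule tendsto_sum)
  have t0: "t \<longlonglongrightarrow> 0" using mt by (rule tendsto_0_if_mult_index_tendsto)
  have "(\<lambda>m. real m * t m - real s * t m) \<longlonglongrightarrow> sum l K - real s * 0"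
    by (intro tendsto_intros mt t0)
  moreover have "\<forall>\<^sub>F m in sequentially. real m * t m - real s * t m = real (m - s) * t m"
    using eventually_ge_at_top[of s] by eventually_elim (simp add: of_nat_diff left_diff_distrib)
  \<comment> \<open>Truncated subtraction makes this differ from the previous limit for the finitely many \<open>m < s\<close>.\<close>
  ultimately have "(\<lambda>m. real (m - s) * t m) \<longlonglongrightarrow> sum l K" by (simp add: tendsto_cong)
  with t0 have exp_lim: "(\<lambda>m. (1 - t m) ^ (m - s)) \<longlonglongrightarrow> exp (- sum l K)"
    by (rule power_one_minus_tendsto_exp)
  have "(\<lambda>m. fact m / (fact (m - s) * real m ^ s)
              * (\<Prod>k\<in>K. (real m * p m k) ^ n k / fact (n k)) * (1 - t m) ^ (m - s))
         \<longlonglongrightarrow> 1 * (\<Prod>k\<in>K. l k ^ n k / fact (n k)) * exp (- sum l K)"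
    by (intro tendsto_mult fact_ratio_tendsto_1 exp_lim tendsto_prod tendsto_divide
        tendsto_power mp tendsto_const) simp_all
  moreover have "\<forall>\<^sub>F m in sequentially.
      fact m / (fact (m - s) * real m ^ s)
              * (\<Prod>k\<in>K. (real m * p m k) ^ n k / fact (n k)) * (1 - t m) ^ (m - s)
      = fact m / (fact (m - s) * (\<Prod>k\<in>K. fact (n k))) * (\<Prod>k\<in>K. p m k ^ n k) * (1 - t m) ^ (m - s)"
    using eventually_gt_at_top[of 0]
  proof eventually_elim
    case (elim m)
    have "(\<Prod>k\<in>K. (real m * p m k) ^ n k / fact (n k))
        = real m ^ s * (\<Prod>k\<in>K. p m k ^ n k) / (\<Prod>k\<in>K. fact (n k))"
      by (simp add: power_mult_distrib prod.distrib prod_dividef s_def power_sum)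
    then show ?case using elim by simp
  qed
  moreover have "1 * (\<Prod>k\<in>K. l k ^ n k / fact (n k)) * exp (- sum l K)
      = (\<Prod>k\<in>K. l k ^ n k * exp (- l k) / fact (n k))"
    using fin by (simp add: prod.distrib prod_dividef exp_sum sum_negf[symmetric])
  ultimately show ?thesis
    unfolding s_def t_def by (simp add: tendsto_cong)
qed simp

section \<open>Exact distribution of the cell counts\<close>

text \<open>All counts of a sample are recorded at once by the multiset of its values. Enumerating the
  index set by a distinct list, the sample has multiset \<open>A\<close> iff its list of values is one of
  the permutations of \<open>A\<close>. By independence these are equally likely, and their number is the
  multinomial coefficient.\<close>

lemma (in prob_space) prob_image_mset_eq:
  assumes indep: "indep_vars (\<lambda>_. count_space UNIV) Z I"
    and I: "finite I" "I \<noteq> {}"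
    and p: "\<And>i k. i \<in> I \<Longrightarrow> k \<in># A \<Longrightarrow> prob {\<omega> \<in> space M. Z i \<omega> = k} = p k"
    and size: "size A = card I"
  shows "prob {\<omega> \<in> space M. image_mset (\<lambda>i. Z i \<omega>) (mset_set I) = A}
       = fact (card I) * (\<Prod>k\<in>set_mset A. p k ^ count A k / fact (count A k))"
proof -
  obtain xs where xs: "set xs = I" "distinct xs"
    using finite_distinct_list[OF I(1)] by blast
  then have mset_xs: "mset xs = mset_set I" and len: "length xs = card I"
    by (auto simp: mset_set_set distinct_card)
  define E where "E = (\<lambda>ks. {\<omega> \<in> space M. map (\<lambda>i. Z i \<omega>) xs = ks})"
  have rv: "Z i \<in> measurable M (count_space UNIV)" if "i \<in> I" for i
    using indep that by (auto simp: indep_vars_def)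
  have E: "E ks \<in> events \<and> prob (E ks) = (\<Prod>k\<in>set_mset A. p k ^ count A k)"
    if "ks \<in> permutations_of_multiset A" for ks
  proof -
    have ks: "mset ks = A" "length ks = card I"
      using that size by (auto simp: permutations_of_multiset_def)
    \<comment> \<open>The list \<open>ks\<close> as a function on the index set, so that the event becomes an intersection over \<open>I\<close>.\<close>
    define k where "k = (\<lambda>i. ks ! (THE a. a < length xs \<and> xs ! a = i))"
    have k: "k (xs ! a) = ks ! a" if "a < length xs" for a
    proof -
      have "(THE b. b < length xs \<and> xs ! b = xs ! a) = a"
        using that xs(2) by (intro the_equality) (auto simp: nth_eq_iff_index_eq)
      then show ?thesis by (simp add: k_def)
    qed
    have map_k: "map k xs = ks"
      using k ks len by (intro nth_equalityI) auto
    have "map (\<lambda>i. Z i \<omega>) xs = ks \<longleftrightarrow> (\<forall>i\<in>I. Z i \<omega> = k i)" for \<omega>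
      unfolding map_k[symmetric] xs(1)[symmetric] by auto
    then have E_eq: "E ks = (\<Inter>i\<in>I. Z i -` {k i} \<inter> space M)"
      using I(2) by (auto simp: E_def)
    have "prob (E ks) = (\<Prod>i\<in>I. prob (Z i -` {k i} \<inter> space M))"
      unfolding E_eq using I by (intro indep_varsD[OF indep]) auto
    also have "\<dots> = (\<Prod>i\<in>I. p (k i))"
    proof (rule prod.cong)
      fix i assume i: "i \<in> I"
      then have "k i \<in># A"
        using ks(1) map_k xs(1) by force
      then show "prob (Z i -` {k i} \<inter> space M) = p (k i)"
        using p[OF i] by (simp add: vimage_def Int_def conj_commute)
    qed simp
    also have "\<dots> = prod_mset (image_mset p (mset ks))"
      unfolding map_k[symmetric] mset_map mset_xs
      by (simp add: prod_unfold_prod_mset image_mset.compositionality o_def)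
    also have "\<dots> = (\<Prod>k\<in>set_mset A. p k ^ count A k)"
      by (simp add: ks(1) image_prod_mset_multiplicity)
    finally have "prob (E ks) = (\<Prod>k\<in>set_mset A. p k ^ count A k)" .
    moreover have "E ks \<in> events"
      unfolding E_eq using I by (intro sets.finite_INT measurable_sets[OF rv]) auto
    ultimately show ?thesis by blast
  qed
  have "{\<omega> \<in> space M. image_mset (\<lambda>i. Z i \<omega>) (mset_set I) = A}
      = (\<Union>ks\<in>permutations_of_multiset A. E ks)"
    by (auto simp: E_def permutations_of_multiset_def mset_xs[symmetric])
  also have "prob \<dots> = (\<Sum>ks\<in>permutations_of_multiset A. prob (E ks))"
    by (intro finite_measure_finite_Union)
      (use E in \<open>auto simp: disjoint_family_on_def E_def\<close>)
  also have "\<dots> = real (card (permutations_of_multiset A)) * (\<Prod>k\<in>set_mset A. p k ^ count A k)"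
    using E by simp
  also have "real (card (permutations_of_multiset A))
      = fact (card I) / (\<Prod>k\<in>set_mset A. fact (count A k))"
    unfolding card_permutations_of_multiset(1) size
    using card_permutations_of_multiset(2)[of A] size
    by (simp add: real_of_nat_div)
  finally show ?thesis by (simp add: prod_dividef)
qed

text \<open>The counts in the cells \<open>K\<close>, together with the sample size, force the count of the residual
  cell \<open>z\<close>, so that prescribing them amounts to prescribing the multiset of all values.\<close>

lemma (in prob_space) prob_multinomial:
  fixes Z :: "'i \<Rightarrow> 'a \<Rightarrow> 'k" and n :: "'k \<Rightarrow> nat"
  assumes indep: "indep_vars (\<lambda>_. count_space UNIV) Z I"
    and I: "finite I" "I \<noteq> {}"
    and K: "finite K" "z \<notin> K"
    and Z: "\<And>i \<omega>. i \<in> I \<Longrightarrow> \<omega> \<in> space M \<Longrightarrow> Z i \<omega> \<in> insert z K"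
    and p: "\<And>i k. i \<in> I \<Longrightarrow> k \<in> K \<Longrightarrow> prob {\<omega> \<in> space M. Z i \<omega> = k} = p k"
    and n: "sum n K \<le> card I"
  shows "prob {\<omega> \<in> space M. \<forall>k\<in>K. card {i \<in> I. Z i \<omega> = k} = n k}
       = fact (card I) / (fact (card I - sum n K) * (\<Prod>k\<in>K. fact (n k)))
         * (\<Prod>k\<in>K. p k ^ n k) * (1 - (\<Sum>k\<in>K. p k)) ^ (card I - sum n K)"
proof -
  define r where "r = card I - sum n K"
  define A where "A = replicate_mset r z + (\<Sum>k\<in>K. replicate_mset (n k) k)"
  define p' where "p' = p(z := 1 - (\<Sum>k\<in>K. p k))"
  have count_A: "count A k = (if k = z then r else if k \<in> K then n k else 0)" for k
  proof -
    have "count A k = (if k = z then r else 0) + (\<Sum>j\<in>K. if j = k then n j else 0)"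
      by (auto simp: A_def count_sum intro!: sum.cong)
    also have "\<dots> = (if k = z then r else if k \<in> K then n k else 0)"
      using K by simp
    finally show ?thesis .
  qed
  have size_A: "size A = card I"
    using n by (simp add: A_def r_def size_multiset_sum)
  have rv: "Z i \<in> measurable M (count_space UNIV)" if "i \<in> I" for i
    using indep that by (auto simp: indep_vars_def)
  have ev: "{\<omega> \<in> space M. Z i \<omega> = k} \<in> events" if "i \<in> I" for i k
  proof -
    have "Z i -` {k} \<inter> space M \<in> events" using rv[OF that] by (rule measurable_sets) simp
    then show ?thesis by (simp add: vimage_def Int_def conj_commute)
  qed
  have p': "prob {\<omega> \<in> space M. Z i \<omega> = k} = p' k" if i: "i \<in> I" and k: "k \<in> insert z K" for i k
  proof (cases "k = z")
    case True
    have "{\<omega> \<in> space M. Z i \<omega> = z} = space M - (\<Union>k\<in>K. {\<omega> \<in> space M. Z i \<omega> = k})"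
      using Z[OF i] K by auto
    also have "prob \<dots> = 1 - prob (\<Union>k\<in>K. {\<omega> \<in> space M. Z i \<omega> = k})"
      using K ev[OF i] by (intro prob_compl sets.finite_UN) auto
    also have "prob (\<Union>k\<in>K. {\<omega> \<in> space M. Z i \<omega> = k}) = (\<Sum>k\<in>K. prob {\<omega> \<in> space M. Z i \<omega> = k})"
      using K ev[OF i] by (intro finite_measure_finite_Union) (auto simp: disjoint_family_on_def)
    also have "\<dots> = sum p K" using p[OF i] by simp
    finally show ?thesis using True by (simp add: p'_def)
  next
    case False
    then show ?thesis using k p[OF i] by (simp add: p'_def)
  qed
  have "(\<forall>k\<in>K. card {i \<in> I. Z i \<omega> = k} = n k) \<longleftrightarrow> image_mset (\<lambda>i. Z i \<omega>) (mset_set I) = A"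
    if \<omega>: "\<omega> \<in> space M" for \<omega>
  proof -
    define B where "B = image_mset (\<lambda>i. Z i \<omega>) (mset_set I)"
    have count_B: "count B k = card {i \<in> I. Z i \<omega> = k}" for k
      using I by (simp add: B_def count_image_mset' eq_commute[of k])
    have B_K: "set_mset B \<subseteq> insert z K"
      using Z \<omega> I by (auto simp: B_def)
    have sizes: "size C = count C z + (\<Sum>k\<in>K. count C k)" if "set_mset C \<subseteq> insert z K" for C
    proof -
      have "size C = (\<Sum>k\<in>insert z K. count C k)"
        unfolding size_multiset_overloaded_eq using that K
        by (intro sum.mono_neutral_left) (auto simp: not_in_iff)
      then show ?thesis using K by simp
    qed
    have A_K: "set_mset A \<subseteq> insert z K"
      by (auto simp: set_mset_def count_A split: if_splits)
    show ?thesis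
    proof
      assume cnt: "\<forall>k\<in>K. card {i \<in> I. Z i \<omega> = k} = n k"
      have eq_K: "count B k = count A k" if "k \<in> K" for k
        using cnt that K by (auto simp: count_A count_B)
      have "size B = size A" using size_A I by (simp add: B_def)
      then have "count B z = count A z"
        using sizes[OF A_K] sizes[OF B_K] eq_K by simp
      moreover have "count B k = count A k" if "k \<notin> insert z K" for k
        using that B_K A_K by (metis count_inI subsetD)
      ultimately have "B = A" using eq_K by (intro multiset_eqI) (metis insert_iff)
      then show "image_mset (\<lambda>i. Z i \<omega>) (mset_set I) = A" by (simp add: B_def)
    next
      assume "image_mset (\<lambda>i. Z i \<omega>) (mset_set I) = A"
      then have "count B k = count A k" for k by (simp add: B_def)
      then show "\<forall>k\<in>K. card {i \<in> I. Z i \<omega> = k} = n k"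
        using K by (auto simp: count_A count_B)
    qed
  qed
  then have "prob {\<omega> \<in> space M. \<forall>k\<in>K. card {i \<in> I. Z i \<omega> = k} = n k}
      = prob {\<omega> \<in> space M. image_mset (\<lambda>i. Z i \<omega>) (mset_set I) = A}"
    by (intro arg_cong[of _ _ prob]) auto
  also have "\<dots> = fact (card I) * (\<Prod>k\<in>set_mset A. p' k ^ count A k / fact (count A k))"
  proof (rule prob_image_mset_eq[OF indep I _ size_A])
    fix i k assume "i \<in> I" "k \<in># A"
    moreover from this have "k \<in> insert z K"
      by (auto simp: set_mset_def count_A split: if_splits)
    ultimately show "prob {\<omega> \<in> space M. Z i \<omega> = k} = p' k" by (intro p')
  qed
  also have "(\<Prod>k\<in>set_mset A. p' k ^ count A k / fact (count A k))
      = (\<Prod>k\<in>insert z K. p' k ^ count A k / fact (count A k))"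
    using K by (intro prod.mono_neutral_left) (auto simp: set_mset_def count_A split: if_splits)
  also have "\<dots> = (1 - sum p K) ^ r / fact r * (\<Prod>k\<in>K. p' k ^ count A k / fact (count A k))"
    using K by (simp add: count_A p'_def)
  also have "(\<Prod>k\<in>K. p' k ^ count A k / fact (count A k)) = (\<Prod>k\<in>K. p k ^ n k / fact (n k))"
    using K by (intro prod.cong) (auto simp: count_A p'_def)
  finally show ?thesis by (simp add: r_def prod_dividef)
qed

section \<open>Cell probabilities and their limit\<close>

text \<open>The event \<open>X \<in> A\<close> belongs to the sigma-algebra generated by \<open>X\<close>, so on it the indicator of \<open>E\<close>
  can be replaced by its conditional expectation, a function of \<open>X\<close>, and the integral can be
  transported to the law of \<open>X\<close>.\<close>

lemma (in prob_space) prob_joint_eq_integral_cond_prob: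
  assumes X: "X \<in> borel_measurable M" and E: "E \<in> events" and A: "A \<in> sets borel"
    and g: "g \<in> borel_measurable borel"
    and cond: "AE \<omega> in M. real_cond_exp M (vimage_algebra (space M) X borel) (indicator E) \<omega> = g (X \<omega>)"
  shows "prob {\<omega> \<in> E. X \<omega> \<in> A} = (\<integral>x. indicator A x * g x \<partial>distr M borel X)"
proof -
  define \<F> where "\<F> = vimage_algebra (space M) X borel"
  have "sets \<F> \<subseteq> events"
    using X unfolding \<F>_def by (intro sets_image_in_sets) auto
  then have "subalgebra M \<F>"
    by (simp add: subalgebra_def \<F>_def)
  then interpret \<F>: finite_measure_subalgebra M \<F>
    by unfold_locales
  define B where "B = X -` A \<inter> space M"
  have B: "B \<in> sets \<F>" "B \<in> events"
    using A X by (auto simp: B_def \<F>_def intro: in_vimage_algebra measurable_sets)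
  have "{\<omega> \<in> E. X \<omega> \<in> A} = B \<inter> E"
    using sets.sets_into_space[OF E] by (auto simp: B_def)
  then have "prob {\<omega> \<in> E. X \<omega> \<in> A} = (\<integral>\<omega>\<in>B. indicator E \<omega> \<partial>M)"
    using B E by (simp add: set_lebesgue_integral_def indicator_inter_arith[symmetric])
  also have "\<dots> = (\<integral>\<omega>\<in>B. real_cond_exp M \<F> (indicator E) \<omega> \<partial>M)"
    using B E by (intro \<F>.real_cond_exp_intA) (auto simp: emeasure_eq_measure)
  also have "\<dots> = (\<integral>\<omega>. indicator A (X \<omega>) * g (X \<omega>) \<partial>M)"
    unfolding set_lebesgue_integral_def
  proof (rule integral_cong_AE)
    show "AE \<omega> in M. indicator B \<omega> *\<^sub>R real_cond_exp M \<F> (indicator E) \<omega>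
        = indicator A (X \<omega>) * g (X \<omega>)"
      using cond by (auto simp: \<F>_def[symmetric] B_def indicator_def)
    show "(\<lambda>\<omega>. indicator B \<omega> *\<^sub>R real_cond_exp M \<F> (indicator E) \<omega>) \<in> borel_measurable M"
      using B by measurable
    show "(\<lambda>\<omega>. indicator A (X \<omega>) * g (X \<omega>)) \<in> borel_measurable M"
      using X g A by measurable
  qed
  also have "\<dots> = (\<integral>x. indicator A x * g x \<partial>distr M borel X)"
    using X g A by (subst integral_distr) auto
  finally show ?thesis .
qed

lemma borel_measurable_exp_q [measurable]: "exp_q q \<in> borel_measurable borel"
  unfolding exp_q_def by measurable

text \<open>Dominated convergence; the constant bound comes from monotonicity of \<open>G\<close> and a maximiser of
  the linear form on \<open>A\<close>, where finiteness of the q-exponential is used.\<close>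

lemma scaled_integral_tendsto_intensity:
  fixes F :: "(real ^ 'p) measure" and G :: "real \<Rightarrow> real"
  assumes F: "prob_space F" "sets F = sets borel"
    and G: "mono G" "\<And>x. G x \<ge> 0"
    and d_pos: "\<And>m. m \<ge> 1 \<Longrightarrow> d m > 0"
    and tail: "\<And>z. (\<lambda>m. ennreal (real m * G (c m + d m * z))) \<longlonglongrightarrow> exp_q q z"
    and A: "compact A" "\<And>x. x \<in> A \<Longrightarrow> exp_q q (\<alpha> + \<beta> \<bullet> x) < \<infinity>"
  shows "(\<lambda>m. real m * (\<integral>x. indicator A x * G ((c m + d m * \<alpha>) + (d m *\<^sub>R \<beta>) \<bullet> x) \<partial>F))
           \<longlonglongrightarrow> measure (intensity F q \<alpha> \<beta>) A"
proof (cases "A = {}")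
  case False
  interpret F: prob_space F by fact
  have A_sets: "A \<in> sets borel" "A \<in> sets F"
    using A(1) F(2) by (auto intro: borel_compact)
  have [measurable]: "G \<in> borel_measurable borel" using G(1) by (rule borel_measurable_mono)
  note [measurable_cong] = F(2)
  note [measurable] = A_sets(1)
  define h where "h = (\<lambda>m x. real m * G (c m + d m * (\<alpha> + \<beta> \<bullet> x)))"
  define e where "e = (\<lambda>x. enn2real (exp_q q (\<alpha> + \<beta> \<bullet> x)))"
  have [measurable]: "e \<in> borel_measurable borel" unfolding e_def by measurable
  have lin: "(c m + d m * \<alpha>) + (d m *\<^sub>R \<beta>) \<bullet> x = c m + d m * (\<alpha> + \<beta> \<bullet> x)" for m x
    by (simp add: algebra_simps)
  have h_lim: "(\<lambda>m. h m x) \<longlonglongrightarrow> e x" if "x \<in> A" for x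
  proof -
    have "(\<lambda>m. enn2real (ennreal (h m x))) \<longlonglongrightarrow> e x"
      unfolding h_def e_def using tail A(2)[OF that] by (intro tendsto_enn2real) simp_all
    then show ?thesis using G(2) by (simp add: h_def)
  qed
  obtain x0 where x0: "x0 \<in> A" "\<And>x. x \<in> A \<Longrightarrow> \<alpha> + \<beta> \<bullet> x \<le> \<alpha> + \<beta> \<bullet> x0"
  proof -
    have "continuous_on A (\<lambda>x. \<alpha> + \<beta> \<bullet> x)" by (intro continuous_intros)
    from continuous_attains_sup[OF A(1) False this] show thesis using that by blast
  qed
  have h_le: "h m x \<le> h m x0" if "x \<in> A" for m x
  proof (cases "m = 0")
    case False
    then have "d m > 0" using d_pos by simp
    then show ?thesis unfolding h_def
      using x0(2)[OF that] by (intro mult_left_mono monoD[OF G(1)]) auto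
  qed (simp add: h_def)
  have "Bseq (\<lambda>m. h m x0)"
    using h_lim[OF x0(1)] by (intro convergent_imp_Bseq) (auto simp: convergent_def)
  then obtain C where C: "\<And>m. \<bar>h m x0\<bar> \<le> C" by (auto simp: Bseq_def)
  have "(\<lambda>m. \<integral>x. indicator A x * h m x \<partial>F) \<longlonglongrightarrow> (\<integral>x. indicator A x * e x \<partial>F)"
  proof (rule integral_dominated_convergence[where w = "\<lambda>_. C"])
    show "AE x in F. (\<lambda>m. indicator A x * h m x) \<longlonglongrightarrow> indicator A x * e x"
      using h_lim by (auto intro!: AE_I2 simp: indicator_def)
    show "AE x in F. norm (indicator A x * h m x) \<le> C" for m
    proof (rule AE_I2)
      fix x
      have "0 \<le> h m x" using G(2) by (simp add: h_def)
      moreover have "0 \<le> C" using C[of 0] by linarith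
      moreover have "h m x \<le> C" if "x \<in> A" using h_le[OF that, of m] C[of m] by linarith
      ultimately show "norm (indicator A x * h m x) \<le> C" by (auto simp: indicator_def)
    qed
  qed (auto simp: h_def)
  moreover have "measure (intensity F q \<alpha> \<beta>) A = (\<integral>x. indicator A x * e x \<partial>F)"
  proof -
    have "emeasure (intensity F q \<alpha> \<beta>) A = (\<integral>\<^sup>+x. exp_q q (\<alpha> + \<beta> \<bullet> x) * indicator A x \<partial>F)"
      unfolding intensity_def using A_sets by (intro emeasure_density) auto
    also have "\<dots> = (\<integral>\<^sup>+x. ennreal (indicator A x * e x) \<partial>F)"
      using A(2) by (intro nn_integral_cong) (auto simp: e_def indicator_def)
    finally show ?thesis
      unfolding measure_def by (subst integral_eq_nn_integral) (auto simp: e_def)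
  qed
  ultimately show ?thesis
    unfolding lin by (simp add: h_def mult.left_commute)
qed simp

section \<open>Convergence to the Poisson process\<close>

theorem theorem1:
  fixes F :: "(real ^ 'p) measure" and N :: "real measure" and G :: "real \<Rightarrow> real"
    and q \<alpha> :: real and \<beta> :: "real ^ 'p" and c d :: "nat \<Rightarrow> real"
    and P :: "nat \<Rightarrow> 'w measure"
    and X :: "nat \<Rightarrow> nat \<Rightarrow> 'w \<Rightarrow> real ^ 'p" and Y :: "nat \<Rightarrow> nat \<Rightarrow> 'w \<Rightarrow> nat"
    and J :: nat and n :: "nat \<Rightarrow> nat" and A :: "nat \<Rightarrow> (real ^ 'p) set"
  assumes F: "prob_space F" "sets F = sets borel"
    and G: "real_distribution N" "G = cdf N"
    and d_pos: "\<And>m. m \<ge> 1 \<Longrightarrow> d m > 0"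
    and tail: "\<And>z. (\<lambda>m. ennreal (real m * G (c m + d m * z))) \<longlonglongrightarrow> exp_q q z"
    and sample: "\<And>m. m \<ge> 1 \<Longrightarrow>
      iid_binary_sample (P m) m F (\<lambda>x. G ((c m + d m * \<alpha>) + (d m *\<^sub>R \<beta>) \<bullet> x)) (X m) (Y m)"
    and J: "J \<ge> 1"
    and A_compact: "\<And>j. j \<in> {1..J} \<Longrightarrow> compact (A j)"
    and A_disjoint: "disjoint_family_on A {1..J}"
    and A_finite: "\<And>j x. j \<in> {1..J} \<Longrightarrow> x \<in> A j \<Longrightarrow> exp_q q (\<alpha> + \<beta> \<bullet> x) < \<infinity>"
  shows "(\<lambda>m. measure (P m)
            {\<omega> \<in> space (P m). \<forall>j\<in>{1..J}. num_observed m (X m) (Y m) \<omega> (A j) = n j})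
         \<longlonglongrightarrow> (\<Prod>j=1..J. measure (intensity F q \<alpha> \<beta>) (A j) ^ n j
               * exp (- measure (intensity F q \<alpha> \<beta>) (A j)) / fact (n j))"
proof -
  interpret N: real_distribution N by fact
  have G_mono: "mono G" and G_nonneg: "\<And>x. G x \<ge> 0"
    using G(2) by (auto simp: mono_def N.cdf_nondecreasing N.cdf_nonneg)
  have [measurable]: "G \<in> borel_measurable borel" using G_mono by (rule borel_measurable_mono)
  define K where "K = {1..J}"
  define p where "p = (\<lambda>m j. \<integral>x. indicator (A j) x * G ((c m + d m * \<alpha>) + (d m *\<^sub>R \<beta>) \<bullet> x) \<partial>F)"
  have A_sets [measurable]: "A j \<in> sets borel" if "j \<in> K" for j
    using A_compact that by (auto simp: K_def intro: borel_compact)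
  \<comment> \<open>By disjointness at most one summand is nonzero; \<open>0 \<notin> K\<close> is the label of the residual cell.\<close>
  define cell where "cell = (\<lambda>(x, y::nat). if y = 1 then \<Sum>j\<in>K. if x \<in> A j then j else 0 else 0)"
  have cell_eq: "cell (x, y) = j \<longleftrightarrow> y = 1 \<and> x \<in> A j" if j: "j \<in> K" for x y j
  proof -
    have hit: "(\<Sum>k\<in>K. if x \<in> A k then k else 0) = j'" if "j' \<in> K" "x \<in> A j'" for j'
    proof -
      have "(\<Sum>k\<in>K. if x \<in> A k then k else 0) = (\<Sum>k\<in>K. if k = j' then j' else 0)"
      proof (rule sum.cong)
        fix k assume "k \<in> K"
        then show "(if x \<in> A k then k else 0) = (if k = j' then j' else 0)"
          using disjoint_family_onD[OF A_disjoint, of k j'] that by (auto simp: K_def)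
      qed simp
      then show ?thesis using that by (simp add: K_def)
    qed
    show ?thesis
    proof (cases "y = 1 \<and> (\<exists>k\<in>K. x \<in> A k)")
      case True
      then obtain k where k: "y = 1" "k \<in> K" "x \<in> A k" by blast
      then have "cell (x, y) = k" using hit by (simp add: cell_def)
      moreover have "k = j" if "x \<in> A j" using hit[OF k(2,3)] hit[OF j that] by simp
      ultimately show ?thesis using k by auto
    next
      case False
      then have "cell (x, y) = 0" by (auto simp: cell_def)
      moreover have "j \<noteq> 0" using j by (simp add: K_def)
      ultimately show ?thesis using False j by auto
    qed
  qed
  have cell_range: "cell xy \<in> insert 0 K" for xy
  proof (cases xy)
    case (Pair x y)
    then show ?thesis
      using cell_eq[of _ x y] by (cases "y = 1 \<and> (\<exists>j\<in>K. x \<in> A j)") (auto simp: cell_def)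
  qed
  have cell_meas: "cell \<in> measurable (borel \<Otimes>\<^sub>M count_space UNIV) (count_space UNIV)"
    unfolding cell_def by measurable
  have exact: "measure (P m) {\<omega> \<in> space (P m). \<forall>j\<in>{1..J}. num_observed m (X m) (Y m) \<omega> (A j) = n j}
      = fact m / (fact (m - sum n K) * (\<Prod>k\<in>K. fact (n k)))
         * (\<Prod>k\<in>K. p m k ^ n k) * (1 - (\<Sum>k\<in>K. p m k)) ^ (m - sum n K)"
    if m: "m \<ge> 1" "m \<ge> sum n K" for m
  proof -
    define \<pi> where "\<pi> = (\<lambda>x. G ((c m + d m * \<alpha>) + (d m *\<^sub>R \<beta>) \<bullet> x))"
    note smp = sample[OF m(1), folded \<pi>_def, unfolded iid_binary_sample_def]
    from smp interpret P: prob_space "P m" by simp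
    have indep: "P.indep_vars (\<lambda>_. borel \<Otimes>\<^sub>M count_space UNIV) (\<lambda>i \<omega>. (X m i \<omega>, Y m i \<omega>)) {1..m}"
      using smp by simp
    have pair: "(\<lambda>\<omega>. (X m i \<omega>, Y m i \<omega>)) \<in> measurable (P m) (borel \<Otimes>\<^sub>M count_space UNIV)"
      if "i \<in> {1..m}" for i
      using indep that by (auto simp: P.indep_vars_def)
    have X_meas: "X m i \<in> borel_measurable (P m)"
      and Y_meas: "Y m i \<in> measurable (P m) (count_space UNIV)" if "i \<in> {1..m}" for i
      using measurable_compose[OF pair[OF that] measurable_fst]
        measurable_compose[OF pair[OF that] measurable_snd] by simp_all
    define Z where "Z = (\<lambda>i \<omega>. cell (X m i \<omega>, Y m i \<omega>))"
    have indep_Z: "P.indep_vars (\<lambda>_. count_space UNIV) Z {1..m}"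
      unfolding Z_def using indep cell_meas by (rule P.indep_vars_compose2)
    have pZ: "P.prob {\<omega> \<in> space (P m). Z i \<omega> = k} = p m k" if i: "i \<in> {1..m}" and k: "k \<in> K" for i k
    proof -
      define E where "E = {\<omega> \<in> space (P m). Y m i \<omega> = 1}"
      have "E = Y m i -` {1} \<inter> space (P m)" by (auto simp: E_def)
      then have E: "E \<in> P.events" using Y_meas[OF i] by (auto intro: measurable_sets)
      have "{\<omega> \<in> space (P m). Z i \<omega> = k} = {\<omega> \<in> E. X m i \<omega> \<in> A k}"
        using k by (auto simp: Z_def cell_eq E_def)
      also have "P.prob \<dots> = (\<integral>x. indicator (A k) x * \<pi> x \<partial>distr (P m) borel (X m i))"
      proof (rule P.prob_joint_eq_integral_cond_prob[OF X_meas[OF i] E A_sets[OF k]])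
        show "\<pi> \<in> borel_measurable borel" unfolding \<pi>_def by measurable
        show "AE \<omega> in P m. real_cond_exp (P m) (vimage_algebra (space (P m)) (X m i) borel)
            (indicator E) \<omega> = \<pi> (X m i \<omega>)"
          using smp i by (simp add: E_def)
      qed
      also have "distr (P m) borel (X m i) = F" using smp i by simp
      finally show ?thesis by (simp add: p_def \<pi>_def)
    qed
    have "{i \<in> {1..m}. Y m i \<omega> = 1 \<and> X m i \<omega> \<in> A k} = {i \<in> {1..m}. Z i \<omega> = k}" if "k \<in> K" for k \<omega>
      using that by (auto simp: Z_def cell_eq)
    then have "{\<omega> \<in> space (P m). \<forall>j\<in>{1..J}. num_observed m (X m) (Y m) \<omega> (A j) = n j}
        = {\<omega> \<in> space (P m). \<forall>k\<in>K. card {i \<in> {1..m}. Z i \<omega> = k} = n k}"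
      by (simp add: num_observed_def K_def)
    moreover have "finite K" "0 \<notin> K" by (simp_all add: K_def)
    moreover have "Z i \<omega> \<in> insert 0 K" for i \<omega>
      unfolding Z_def by (rule cell_range)
    ultimately show ?thesis
      using P.prob_multinomial[OF indep_Z, of K 0 "p m" n] pZ m by simp
  qed
  have "(\<lambda>m. real m * p m k) \<longlonglongrightarrow> measure (intensity F q \<alpha> \<beta>) (A k)" if "k \<in> K" for k
    unfolding p_def
    by (rule scaled_integral_tendsto_intensity[OF F G_mono G_nonneg d_pos tail])
      (use A_compact A_finite that in \<open>auto simp: K_def\<close>)
  then have "(\<lambda>m. fact m / (fact (m - sum n K) * (\<Prod>k\<in>K. fact (n k)))
         * (\<Prod>k\<in>K. p m k ^ n k) * (1 - (\<Sum>k\<in>K. p m k)) ^ (m - sum n K))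
      \<longlonglongrightarrow> (\<Prod>k\<in>K. measure (intensity F q \<alpha> \<beta>) (A k) ^ n k
               * exp (- measure (intensity F q \<alpha> \<beta>) (A k)) / fact (n k))"
    by (rule multinomial_tendsto_poisson)
  moreover have "\<forall>\<^sub>F m in sequentially.
      fact m / (fact (m - sum n K) * (\<Prod>k\<in>K. fact (n k)))
         * (\<Prod>k\<in>K. p m k ^ n k) * (1 - (\<Sum>k\<in>K. p m k)) ^ (m - sum n K)
      = measure (P m) {\<omega> \<in> space (P m). \<forall>j\<in>{1..J}. num_observed m (X m) (Y m) \<omega> (A j) = n j}"
    using eventually_ge_at_top[of "max 1 (sum n K)"]
    by eventually_elim (simp only: exact max.bounded_iff)
  ultimately show ?thesis
    unfolding K_def by (rule Lim_transform_eventually)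
qed

end
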